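(* Let $p\in\Sigma^*$ be a binary pattern with reversal. Then the avoidability index of $p$ is $2$, $3$ or $\infty$.
   Context: $\Sigma=\{x,x^R,y,y^R\}$ is a four-letter alphabet; a word $p\in\Sigma^*$ is called a binary pattern with reversal. For a positive integer $k$, $T_k=\{0,1,\ldots,k-1\}$. For a word $w=a_1a_2\cdots a_n\in T_k^*$ ($a_i\in T_k$), $w^R=a_na_{n-1}\cdots a_1$ is its reversal. A morphism $f:\Sigma^*\to T_k^*$ respects reversal if $f(x^R)=f(x)^R$ and $f(y^R)=f(y)^R$. An instance of $p$ is the image of $p$ under some non-erasing morphism that respects reversal (non-erasing: the image of every letter is non-empty). A word $w$ avoids $p$ if no factor (contiguous subword) of $w$ is an instance of $p$. The pattern $p$ is $k$-avoidable if there are arbitrarily long words of $T_k^*$ which avoid $p$; equivalently, there is an $\omega$-word over $T_k$ every finite prefix of which avoids $p$. The pattern $p$ is avoidable if it is $k$-avoidable for some positive integer $k$, and otherwise it is unavoidable. If $p$ is avoidable, its avoidability index is the least $k$ such that $p$ is $k$-avoidable; if $p$ is unavoidable, its avoidability index is $\infty$. *)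

theory Defs
  imports Main "HOL-Library.Sublist" "HOL-Library.Extended_Nat"
begin

datatype pletter = x_let | xR_let | y_let | yR_let

type_synonym pattern = "pletter list"

definition T :: "nat \<Rightarrow> nat set" where
  "T k = {0..<k}"

definition morphism :: "nat \<Rightarrow> (pattern \<Rightarrow> nat list) \<Rightarrow> bool" where
  "morphism k f \<longleftrightarrow> (\<forall>u. f u \<in> lists (T k)) \<and> f [] = [] \<and> (\<forall>u v. f (u @ v) = f u @ f v)"

definition respects_reversal :: "(pattern \<Rightarrow> nat list) \<Rightarrow> bool" where
  "respects_reversal f \<longleftrightarrow> f [xR_let] = rev (f [x_let]) \<and> f [yR_let] = rev (f [y_let])"

definition non_erasing :: "(pattern \<Rightarrow> nat list) \<Rightarrow> bool" where
  "non_erasing f \<longleftrightarrow> (\<forall>a. f [a] \<noteq> [])"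

definition is_instance :: "nat \<Rightarrow> pattern \<Rightarrow> nat list \<Rightarrow> bool" where
  "is_instance k p w \<longleftrightarrow>
     (\<exists>f. morphism k f \<and> respects_reversal f \<and> non_erasing f \<and> w = f p)"

definition avoids :: "nat \<Rightarrow> nat list \<Rightarrow> pattern \<Rightarrow> bool" where
  "avoids k w p \<longleftrightarrow> (\<forall>v. sublist v w \<longrightarrow> \<not> is_instance k p v)"

definition k_avoidable :: "nat \<Rightarrow> pattern \<Rightarrow> bool" where
  "k_avoidable k p \<longleftrightarrow> (\<forall>n. \<exists>w \<in> lists (T k). length w \<ge> n \<and> avoids k w p)"

definition avoidable :: "pattern \<Rightarrow> bool" where
  "avoidable p \<longleftrightarrow> (\<exists>k>0. k_avoidable k p)"

definition avoidability_index :: "pattern \<Rightarrow> enat" where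
  "avoidability_index p =
     (if avoidable p then enat (LEAST k. k > 0 \<and> k_avoidable k p) else \<infinity>)"

end

theory Submission
  imports Defs
begin

text \<open>Two ternary words suffice. A squarefree word avoids every pattern in which two letters on the
  same variable are adjacent, since an instance of $x x^R$ contains a doubled letter. All other
  patterns alternate between the variables. Those of length at least 4 are avoided by a ternary word
  without squares $zz$, $|z| \ge 2$, in which each letter is followed by itself or by its successor
  modulo 3: there a factor whose reversal is also a factor is constant, so reversal disappears and an
  instance of a four-letter alternating pattern is a square $uvuv$. Alternating patterns of length
  at most 3 are unavoidable, because a long word repeats a letter at distance at least 2.\<close>

section \<open>The Thue-Morse word is overlap-free\<close>

text \<open>The Thue-Morse word: the parity of the number of ones in the binary expansion.\<close>

fun tm :: "nat \<Rightarrow> bool" where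
  "tm n = (if n = 0 then False else odd n \<noteq> tm (n div 2))"

declare tm.simps [simp del]

lemma tm_even: "tm (2 * n) = tm n"
  by (cases "n = 0") (simp_all add: tm.simps[of "2 * n"] tm.simps[of 0])

lemma tm_odd: "tm (Suc (2 * n)) \<longleftrightarrow> \<not> tm n"
  by (simp add: tm.simps[of "Suc (2 * n)"])

lemma tm_parity: "tm n \<longleftrightarrow> odd n \<noteq> tm (n div 2)"
  using tm_even[of "n div 2"] tm_odd[of "n div 2"] by (cases "even n") auto

lemma tm_even_neq: "even n \<Longrightarrow> tm (Suc n) \<noteq> tm n"
  by (metis evenE tm_even tm_odd)

text \<open>One of \<open>n\<close> and \<open>Suc n\<close> is even, and \<open>tm_even_neq\<close>
  applies there.\<close>

lemma tm_no_cube: "\<not> (tm n = tm (Suc n) \<and> tm (Suc n) = tm (Suc (Suc n)))"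
  using tm_even_neq[of n] tm_even_neq[of "Suc n"] by auto

text \<open>Infinite descent: an even period is halved by passing to the positions of one parity,
  and an odd period yields a cube.\<close>

lemma tm_overlap_free:
  assumes "p > 0" "\<And>i. i \<le> p \<Longrightarrow> tm (s + i + p) = tm (s + i)"
  shows False
  using assms
proof (induction p arbitrary: s rule: less_induct)
  case (less p)
  show False
  proof (cases "even p")
    case True
    then obtain q where q: "p = 2 * q" by auto
    show False
    proof (rule less.IH[of q "s div 2"])
      show "q < p" "q > 0" using q less.prems(1) by auto
      fix i assume "i \<le> q"
      then have "tm (s + 2 * i + p) = tm (s + 2 * i)"
        using less.prems(2)[of "2 * i"] q by simp
      \<comment> \<open>The positions involved share the parity of \<open>s\<close>, so the parity
        terms in \<open>tm_parity\<close> cancel.\<close>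
      moreover have "(s + 2 * i + p) div 2 = s div 2 + i + q" "(s + 2 * i) div 2 = s div 2 + i"
        "odd (s + 2 * i + p) = odd s" "odd (s + 2 * i) = odd s"
        using q by auto
      ultimately show "tm (s div 2 + i + q) = tm (s div 2 + i)"
        using tm_parity[of "s + 2 * i + p"] tm_parity[of "s + 2 * i"] by metis
    qed
  next
    case False
    show False
    proof (cases "p = 1")
      case True
      then show False
        using less.prems(2)[of 0] less.prems(2)[of 1] tm_no_cube[of s] by simp
    next
      case np1: False
      with False have p3: "p \<ge> 3" by (cases p rule: nat.exhaust; force elim: oddE)
      have shift: "tm (m + p) = tm m" if "s \<le> m" "m \<le> s + p" for m
        using less.prems(2)[of "m - s"] that by simp
      \<comment> \<open>The period p swaps the parity of positions, so adjacent letters differ at every position.\<close>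
      have alt: "tm (Suc m) \<noteq> tm m" if "s \<le> m" "m < s + 2 * p" for m
      proof (cases "even m")
        case True
        then show ?thesis by (rule tm_even_neq)
      next
        case odd: False
        show ?thesis
        proof (cases "m < s + p")
          case True
          then show ?thesis
            using shift[of m] shift[of "Suc m"] that odd False tm_even_neq[of "m + p"] by simp
        next
          case ge: False
          define l where "l = m - p"
          have l: "m = l + p" "s \<le> l" "l < s + p" using ge that by (auto simp: l_def)
          then show ?thesis
            using shift[of l] shift[of "Suc l"] odd False tm_even_neq[of l] by simp
        qed
      qed
      \<comment> \<open>\<open>2 * k\<close> is the first even position from \<open>s\<close> on.
        Alternation makes every second letter equal, which is a cube at \<open>k\<close>; the
        positions up to \<open>2 * k + 4\<close> are covered because
        \<open>p \<ge> 3\<close>.\<close>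
      define k where "k = Suc s div 2"
      have k: "s \<le> 2 * k" "2 * k \<le> Suc s" by (auto simp: k_def)
      have "tm (2 * k) = tm (2 * Suc k)"
        using alt[of "2 * k"] alt[of "Suc (2 * k)"] k p3 by simp
      moreover have "tm (2 * Suc k) = tm (2 * Suc (Suc k))"
        using alt[of "2 * Suc k"] alt[of "Suc (2 * Suc k)"] k p3 by simp
      ultimately show False using tm_no_cube[of k] tm_even by metis
    qed
  qed
qed

section \<open>A squarefree ternary word\<close>

text \<open>The difference sequence of the Thue-Morse word, shifted by 1. A square in it telescopes to an
  overlap in the Thue-Morse word.\<close>

definition thue :: "nat \<Rightarrow> nat" where
  "thue n = (if tm n = tm (Suc n) then 1 else if tm n then 0 else 2)"

text \<open>The difference equation without subtraction, so that it telescopes in the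
  naturals.\<close>

lemma thue_eq: "thue n + of_bool (tm n) = 1 + of_bool (tm (Suc n))"
  by (simp add: thue_def)

lemma thue_less_3: "thue n < 3"
  by (simp add: thue_def)

lemma thue_squarefree:
  assumes "p > 0" "\<And>i. i < p \<Longrightarrow> thue (s + i + p) = thue (s + i)"
  shows False
proof -
  have tele: "(of_bool (tm (s + i + p)) :: nat) + of_bool (tm s) = of_bool (tm (s + i)) + of_bool (tm (s + p))"
    if "i \<le> p" for i
    using that
  proof (induction i)
    case (Suc i)
    then show ?case
      using thue_eq[of "s + i + p"] thue_eq[of "s + i"] assms(2)[of i] by simp
  qed simp
  \<comment> \<open>At \<open>i = p\<close> the outer two values sum to twice the middle one; being
    0 or 1, all three agree.\<close>
  have eq: "tm (s + p) = tm s"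
    using tele[of p] by (cases "tm (s + p)"; cases "tm s") (auto simp: of_bool_def split: if_splits)
  show False
  proof (rule tm_overlap_free[OF assms(1)])
    fix i assume "i \<le> p"
    then show "tm (s + i + p) = tm (s + i)"
      using tele[of i] eq by (simp add: of_bool_eq_iff)
  qed
qed

section \<open>A ternary word with cyclic steps and without long squares\<close>

text \<open>The blocks were found by computer search. Their letters at index 5 differ, and \<open>200\<close> occurs in
  their concatenations only across block boundaries. So a square of the image with a long period has
  a period divisible by 8, and index 5 turns it into a square of the preimage.\<close>

definition block :: "nat \<Rightarrow> nat list" where
  "block c = (if c = 0 then [0,0,1,2,2,0,1,2] else if c = 1 then [0,0,0,1,1,1,2,2] else [0,0,0,1,1,2,2,2])"

definition cyc :: "nat \<Rightarrow> nat" where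
  "cyc n = block (thue (n div 8)) ! (n mod 8)"

lemma less_8_cases: "(r::nat) < 8 \<Longrightarrow> r = 0 \<or> r = 1 \<or> r = 2 \<or> r = 3 \<or> r = 4 \<or> r = 5 \<or> r = 6 \<or> r = 7"
  by arith

lemma thue_cases: "thue n = 0 \<or> thue n = 1 \<or> thue n = 2"
  by (simp add: thue_def)

lemma length_block [simp]: "length (block c) = 8"
  by (simp add: block_def)

lemma block_5: "c < 3 \<Longrightarrow> block c ! 5 = c"
  by (auto simp: block_def)

lemma cyc_less_3: "cyc n < 3"
  using less_8_cases[of "n mod 8"] by (auto simp: cyc_def block_def)

lemma cyc_block: "r < 8 \<Longrightarrow> cyc (8 * j + r) = block (thue j) ! r"
  by (simp add: cyc_def)

lemma cyc_5: "cyc (8 * j + 5) = thue j"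
  by (simp add: cyc_block block_5 thue_less_3)

text \<open>Four blocks suffice for the finite check: a square of period at most 9 starting in the
  first block ends at index 24 or earlier.\<close>

lemma cyc_nth:
  assumes "i < 32"
  shows "cyc (8 * j + i) =
    (block (thue j) @ block (thue (j + 1)) @ block (thue (j + 2)) @ block (thue (j + 3))) ! i"
proof -
  consider "i < 8" | r where "i = 8 + r" "r < 8" | r where "i = 16 + r" "r < 8"
    | r where "i = 24 + r" "r < 8"
  proof -
    have "i < 8 \<or> i - 8 < 8 \<and> i = 8 + (i - 8) \<or> i - 16 < 8 \<and> i = 16 + (i - 16)
        \<or> i - 24 < 8 \<and> i = 24 + (i - 24)"
      using assms by arith
    then show thesis using that by metis
  qed
  then show ?thesis
  proof cases
    case 1
    then show ?thesis by (simp add: nth_append cyc_block)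
  next
    case (2 r)
    then show ?thesis using cyc_block[of r "j + 1"] by (simp add: nth_append algebra_simps)
  next
    case (3 r)
    then show ?thesis using cyc_block[of r "j + 2"] by (simp add: nth_append algebra_simps)
  next
    case (4 r)
    then show ?thesis using cyc_block[of r "j + 3"] by (simp add: nth_append algebra_simps)
  qed
qed

definition letters :: "nat list" where
  "letters = [0, 1, 2]"

lemma thue_in_letters: "thue n \<in> set letters"
  using thue_cases[of n] by (auto simp: letters_def)

text \<open>Three consecutive letters meet at most two blocks, so local properties reduce to a
  finite check over pairs of blocks and start indices.\<close>

lemma cyc_window:
  assumes "list_all (\<lambda>a. list_all (\<lambda>b. list_all (\<lambda>r.
      P r ((block a @ block b) ! r) ((block a @ block b) ! (r + 1)) ((block a @ block b) ! (r + 2)))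
      [0,1,2,3,4,5,6,7]) letters) letters"
  shows "P (n mod 8) (cyc n) (cyc (n + 1)) (cyc (n + 2))"
proof -
  define j r where "j = n div 8" "r = n mod 8"
  have n: "n = 8 * j + r" "r < 8" by (auto simp: j_r_def)
  define w where "w = block (thue j) @ block (thue (j + 1))"
  have w: "cyc (8 * j + i) = w ! i" if "i < 16" for i
  proof -
    have "i - 8 < 8" using that by arith
    then show ?thesis using cyc_nth[of i j] that by (simp add: w_def nth_append)
  qed
  have "r \<in> set [0,1,2,3,4,5,6,7]" using less_8_cases[OF n(2)] by simp
  then have "P r (w ! r) (w ! (r + 1)) (w ! (r + 2))"
    using assms thue_in_letters unfolding list_all_iff w_def by blast
  then show ?thesis
    using w[of r] w[of "r + 1"] w[of "r + 2"] n by (simp add: add.assoc)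
qed

lemma cyc_Suc: "cyc (Suc n) = cyc n \<or> cyc (Suc n) = Suc (cyc n) mod 3"
  using cyc_window[of "\<lambda>r x y z. y = x \<or> y = Suc x mod 3" n]
  by (simp add: block_def letters_def)

text \<open>Every block starts with \<open>00\<close> and ends with \<open>2\<close>, and the only
  \<open>20\<close> inside a block is followed by \<open>1\<close>.\<close>

lemma cyc_marker:
  "cyc n = 2 \<and> cyc (Suc n) = 0 \<and> cyc (Suc (Suc n)) = 0 \<longleftrightarrow> n mod 8 = 7"
  using cyc_window[of "\<lambda>r x y z. (x = 2 \<and> y = 0 \<and> z = 0) = (r = 7)" n]
  by (simp add: block_def letters_def)

section \<open>Excluding short squares by evaluation\<close>

text \<open>Executable comparison of prefixes that stops at the first mismatch. Running out of
  letters counts as a mismatch, hence the length premises of \<open>agreeI\<close>.\<close>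

fun agree :: "nat \<Rightarrow> nat list \<Rightarrow> nat list \<Rightarrow> bool" where
  "agree 0 xs ys = True"
| "agree (Suc n) (x # xs) (y # ys) = (if x = y then agree n xs ys else False)"
| "agree (Suc n) _ _ = False"

lemma agreeI:
  "\<lbrakk>n \<le> length xs; n \<le> length ys; \<And>i. i < n \<Longrightarrow> xs ! i = ys ! i\<rbrakk> \<Longrightarrow> agree n xs ys"
proof (induction n xs ys rule: agree.induct)
  case (2 n x xs y ys)
  have "x = y" using 2(4)[of 0] by simp
  moreover have "agree n xs ys"
    using 2(2,3) 2(4)[of "Suc _"] by (intro 2(1)) (auto simp: \<open>x = y\<close>)
  ultimately show ?case by simp
qed auto

fun no_square :: "nat \<Rightarrow> nat \<Rightarrow> nat list \<Rightarrow> bool" where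
  "no_square 0 p w = True"
| "no_square (Suc n) p w = (if agree p w (drop p w) then False else no_square n p (tl w))"

lemma no_squareD: "\<lbrakk>no_square n p w; r < n\<rbrakk> \<Longrightarrow> \<not> agree p (drop r w) (drop (r + p) w)"
proof (induction n p w arbitrary: r rule: no_square.induct)
  case (2 n p w)
  then show ?case
    by (cases r) (auto simp: drop_Suc tl_drop split: if_splits)
qed simp

text \<open>Written with conditionals instead of connectives because only those are evaluated lazily.\<close>

lemma short_squares:
  "list_all (\<lambda>a. list_all (\<lambda>b. list_all (\<lambda>c. list_all (\<lambda>d.
     if a = b \<or> b = c \<or> c = d then True else
     list_all (\<lambda>p. no_square 8 p (block a @ block b @ block c @ block d)) [2,3,4,5,6,7,9])
     letters) letters) letters) letters"
  by code_simp

lemma short_squaresD: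
  assumes "a \<in> set letters" "b \<in> set letters" "c \<in> set letters" "d \<in> set letters"
    and "a \<noteq> b" "b \<noteq> c" "c \<noteq> d" "p \<in> set [2,3,4,5,6,7,9]"
  shows "no_square 8 p (block a @ block b @ block c @ block d)"
proof -
  have "if a = b \<or> b = c \<or> c = d then True else
     \<forall>p\<in>set [2,3,4,5,6,7,9]. no_square 8 p (block a @ block b @ block c @ block d)"
    using short_squares assms(1-4) unfolding list_all_iff by blast
  then have "\<forall>p\<in>set [2,3,4,5,6,7,9]. no_square 8 p (block a @ block b @ block c @ block d)"
    using assms(5-7) by (simp only: if_False simp_thms)
  then show ?thesis using assms(8) by (rule bspec)
qed

lemma cyc_no_short_square:
  assumes "p \<in> {2,3,4,5,6,7,9}" "\<And>i. i < p \<Longrightarrow> cyc (s + i + p) = cyc (s + i)"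
  shows False
proof -
  define j r where "j = s div 8" "r = s mod 8"
  have s: "s = 8 * j + r" and r: "r < 8" by (auto simp: j_r_def)
  define w where "w = block (thue j) @ block (thue (j + 1)) @ block (thue (j + 2)) @ block (thue (j + 3))"
  \<comment> \<open>Squarefreeness separates neighbouring letters, as the guard in
    \<open>short_squares\<close> demands.\<close>
  have "thue (n + 1) \<noteq> thue n" for n
    using thue_squarefree[of 1 n] by auto
  from this[of j] this[of "j + 1"] this[of "j + 2"]
  have neq: "thue j \<noteq> thue (j + 1)" "thue (j + 1) \<noteq> thue (j + 2)" "thue (j + 2) \<noteq> thue (j + 3)"
    by (auto simp: numeral_eq_Suc)
  have p9: "p \<le> 9" using assms(1) by auto
  have "w ! (r + i + p) = w ! (r + i)" if "i < p" for i
    using assms(2)[OF that] cyc_nth[of "r + i + p" j] cyc_nth[of "r + i" j] s r that p9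
    by (simp add: w_def add.assoc)
  moreover have "length w = 32" by (simp add: w_def)
  ultimately have "agree p (drop r w) (drop (r + p) w)"
    using r p9 by (intro agreeI) (simp_all add: add_ac)
  moreover have "no_square 8 p w"
  proof -
    have "p \<in> set [2,3,4,5,6,7,9]" using assms(1) by auto
    then show ?thesis
      unfolding w_def using neq thue_in_letters by (intro short_squaresD)
  qed
  ultimately show False using no_squareD r by blast
qed

text \<open>Period 8 belongs to the multiples of the block length; from period 10 on, the first half
  of a square contains the marker \<open>200\<close>.\<close>

lemma cyc_squarefree:
  assumes "p \<ge> 2" "\<And>i. i < p \<Longrightarrow> cyc (s + i + p) = cyc (s + i)"
  shows False
proof (cases "8 dvd p")
  case True
  then obtain q where q: "p = 8 * q" by auto
  \<comment> \<open>Block of the first position from \<open>s\<close> on that has index 5; it and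
    the following \<open>q - 1\<close> such positions lie in the first half of the square.\<close>
  define j where "j = (s + 2) div 8"
  have j: "s \<le> 8 * j + 5" "8 * j + 5 \<le> s + 7" by (auto simp: j_def)
  show False
  proof (rule thue_squarefree[of q j])
    show "q > 0" using q assms(1) by auto
    fix i assume "i < q"
    then have "cyc (s + (8 * (j + i) + 5 - s) + p) = cyc (s + (8 * (j + i) + 5 - s))"
      using j q by (intro assms(2)) auto
    then have "cyc (8 * (j + i + q) + 5) = cyc (8 * (j + i) + 5)"
      using j q by (simp add: algebra_simps)
    then show "thue (j + i + q) = thue (j + i)"
      unfolding cyc_5 .
  qed
next
  case False
  show False
  proof (cases "p \<le> 9")
    case True
    with False assms(1) have "p \<in> {2,3,4,5,6,7,9}" by (cases "p = 8") auto
    then show False using cyc_no_short_square assms(2) by blast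
  next
    case p: False
    \<comment> \<open>Distance to the next block end. The marker occupies offsets \<open>d\<close>
      to \<open>d + 2\<close>, at most 9 and so below \<open>p\<close>; its copy in the second half
      forces \<open>8 dvd p\<close>.\<close>
    define d where "d = 7 - s mod 8"
    have "s mod 8 < 8" by simp
    then have "s + d = 8 * (s div 8) + 7"
      unfolding d_def using mult_div_mod_eq[of 8 s] by linarith
    then have d: "(s + d) mod 8 = 7" "d \<le> 7" by (simp_all add: d_def)
    have "cyc (s + d + p) = cyc (s + d)" "cyc (Suc (s + d + p)) = cyc (Suc (s + d))"
      "cyc (Suc (Suc (s + d + p))) = cyc (Suc (Suc (s + d)))"
      using assms(2)[of d] assms(2)[of "Suc d"] assms(2)[of "Suc (Suc d)"] d(2) p by simp_all
    then have "(s + d + p) mod 8 = (s + d) mod 8"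
      using cyc_marker[of "s + d"] cyc_marker[of "s + d + p"] d(1) by metis
    then show False
      using False mod_eq_dvd_iff_nat[of "s + d" "s + d + p" 8] by simp
  qed
qed

section \<open>Factors of prefixes of infinite words\<close>

lemma sublist_map_upt:
  assumes "sublist v (map g [0..<N])"
  obtains s where "v = map g [s..<s + length v]"
proof -
  obtain ps ss where eq: "map g [0..<N] = ps @ v @ ss"
    using assms by (auto simp: sublist_def)
  have "v ! i = g (length ps + i)" if "i < length v" for i
  proof -
    have "N = length ps + length v + length ss"
      using arg_cong[OF eq, of length] by simp
    then have "g (length ps + i) = map g [0..<N] ! (length ps + i)" using that by simp
    also have "\<dots> = v ! i" using that by (simp add: eq nth_append)
    finally show ?thesis by simp
  qed
  then have "v = map g [length ps..<length ps + length v]"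
    by (intro nth_equalityI) auto
  then show ?thesis by (rule that)
qed

lemma sublist_square_map_upt:
  assumes "sublist (z @ z) (map g [0..<N])"
  obtains s where "\<And>i. i < length z \<Longrightarrow> g (s + i + length z) = g (s + i)"
proof -
  obtain s where s: "z @ z = map g [s..<s + length (z @ z)]"
    using sublist_map_upt[OF assms] .
  have nth: "(z @ z) ! i = g (s + i)" if "i < 2 * length z" for i
    using arg_cong[OF s, of "\<lambda>l. l ! i"] that by simp
  have "g (s + i + length z) = g (s + i)" if "i < length z" for i
    using nth[of i] nth[of "i + length z"] that by (simp add: nth_append add.assoc)
  then show ?thesis by (rule that)
qed

lemma sublist_thue_no_square:
  assumes "z \<noteq> []"
  shows "\<not> sublist (z @ z) (map thue [0..<N])"
  using assms by (auto elim!: sublist_square_map_upt intro: thue_squarefree[of "length z"])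

lemma sublist_cyc_no_square:
  assumes "length z \<ge> 2"
  shows "\<not> sublist (z @ z) (map cyc [0..<N])"
  using assms by (auto elim!: sublist_square_map_upt intro: cyc_squarefree[of "length z"])

abbreviation cyc_step :: "nat \<Rightarrow> nat \<Rightarrow> bool" where
  "cyc_step a b \<equiv> a < 3 \<and> (b = a \<or> b = Suc a mod 3)"

text \<open>Two successor steps add 2, which is nonzero modulo 3.\<close>

lemma cyc_step_antisym: "cyc_step a b \<Longrightarrow> cyc_step b a \<Longrightarrow> a = b"
  by (auto simp: mod_Suc split: if_splits)

lemma successively_cyc: "sublist u (map cyc [0..<N]) \<Longrightarrow> successively cyc_step u"
proof -
  assume "sublist u (map cyc [0..<N])"
  then obtain s where "u = map cyc [s..<s + length u]" by (rule sublist_map_upt)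
  moreover have "successively cyc_step (map cyc [s..<s + length u])"
    using cyc_Suc cyc_less_3 by (auto simp: successively_conv_nth)
  ultimately show ?thesis by simp
qed

text \<open>Reversal turns every step around, so by antisymmetry neighbours are equal and
  \<open>u\<close> is constant.\<close>

lemma rev_factor_cyc:
  assumes "sublist u (map cyc [0..<N])" "sublist (rev u) (map cyc [0..<M])"
  shows "rev u = u"
proof -
  have "successively cyc_step u" "successively (\<lambda>a b. cyc_step b a) u"
    using assms[THEN successively_cyc] by (simp_all add: successively_rev)
  then have "successively (=) u"
    unfolding successively_conv_nth using cyc_step_antisym by meson
  then have "sorted_wrt (=) u"
    by (simp add: successively_conv_sorted_wrt transp_def)
  then have "u ! i = u ! 0" if "i < length u" for i
    using sorted_wrt_nth_less[of "(=)" u 0 i] that by (cases "i = 0") simp_all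
  then show ?thesis
    by (intro nth_equalityI) (simp_all add: rev_nth)
qed

section \<open>Avoidable patterns\<close>

definition same_var :: "pletter \<Rightarrow> pletter \<Rightarrow> bool" where
  "same_var a b \<longleftrightarrow> (a \<in> {x_let, xR_let} \<longleftrightarrow> b \<in> {x_let, xR_let})"

lemma same_var_image:
  assumes "respects_reversal f" "same_var a b"
  shows "f [b] = f [a] \<or> f [b] = rev (f [a])"
  using assms by (cases a; cases b) (auto simp: same_var_def respects_reversal_def)

lemma same_var_image_neq:
  assumes "respects_reversal f" "same_var a b" "a \<noteq> b"
  shows "f [b] = rev (f [a])"
  using assms by (cases a; cases b) (auto simp: same_var_def respects_reversal_def)

lemma morphism_append: "morphism k f \<Longrightarrow> f (u @ v) = f u @ f v"
  by (simp add: morphism_def)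

text \<open>Restricted to two or more letters so that rewriting stops at
  \<open>f [a]\<close>.\<close>

lemma morphism_Cons2: "morphism k f \<Longrightarrow> f (a # b # u) = f [a] @ f (b # u)"
  using morphism_append[of k f "[a]" "b # u"] by simp

text \<open>\<open>f q\<close> is a factor of \<open>f p\<close> for every morphism
  \<open>f\<close>.\<close>

lemma avoids_mono: "avoids k w q \<Longrightarrow> sublist q p \<Longrightarrow> avoids k w p"
  unfolding avoids_def is_instance_def sublist_def
  by (metis append.assoc morphism_append)

text \<open>The prefixes of one infinite word \<open>g\<close> supply witnesses of every
  length.\<close>

lemma k_avoidable_3I:
  assumes "sublist q p" "\<And>n. g n < 3"
    and "\<And>f N. \<lbrakk>morphism 3 f; respects_reversal f; non_erasing f\<rbrakk> \<Longrightarrow> \<not> sublist (f q) (map g [0..<N])"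
  shows "k_avoidable 3 p"
  unfolding k_avoidable_def
proof
  fix n
  have "avoids 3 (map g [0..<n]) q"
    using assms(3) by (auto simp: avoids_def is_instance_def)
  then have "avoids 3 (map g [0..<n]) p" using assms(1) by (rule avoids_mono)
  moreover have "map g [0..<n] \<in> lists (T 3)" using assms(2) by (auto simp: T_def)
  ultimately show "\<exists>w\<in>lists (T 3). n \<le> length w \<and> avoids 3 w p"
    by (intro bexI[of _ "map g [0..<n]"]) auto
qed

lemma avoidable_adjacent:
  assumes "sublist [a, b] p" "same_var a b"
  shows "k_avoidable 3 p"
proof (rule k_avoidable_3I[OF assms(1) thue_less_3])
  fix f N
  assume f: "morphism 3 f" "respects_reversal f" "non_erasing f"
  have ne: "f [a] \<noteq> []" using f(3) by (simp add: non_erasing_def)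
  show "\<not> sublist (f [a, b]) (map thue [0..<N])"
  proof
    assume sub: "sublist (f [a, b]) (map thue [0..<N])"
    obtain z where "z \<noteq> []" "sublist (z @ z) (f [a, b])"
    proof (cases "a = b")
      case True
      then show ?thesis using that[of "f [a]"] ne morphism_Cons2[OF f(1)] by simp
    next
      case False
      then have "f [a, b] = f [a] @ rev (f [a])"
        using same_var_image_neq[OF f(2) assms(2)] morphism_Cons2[OF f(1)] by simp
      \<comment> \<open>The last letter of \<open>f [a]\<close> meets its mirror image, so
        \<open>z = [c]\<close> works.\<close>
      moreover obtain u c where "f [a] = u @ [c]" using ne by (metis rev_exhaust)
      ultimately have "f [a, b] = u @ ([c] @ [c]) @ rev u" by simp
      then have "sublist ([c] @ [c]) (f [a, b])" by (metis sublist_appendI)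
      then show ?thesis using that by blast
    qed
    then show False using sublist_thue_no_square sub by (metis sublist_order.order_trans)
  qed
qed

lemma avoidable_alternating:
  assumes "sublist [a, b, a', b'] p" "same_var a a'" "same_var b b'"
  shows "k_avoidable 3 p"
proof (rule k_avoidable_3I[OF assms(1) cyc_less_3])
  fix f N
  assume f: "morphism 3 f" "respects_reversal f" "non_erasing f"
  define u v u' v' where "u = f [a]" "v = f [b]" "u' = f [a']" "v' = f [b']"
  note defs = this
  have fp: "f [a, b, a', b'] = u @ v @ u' @ v'"
    by (simp add: morphism_Cons2[OF f(1)] defs)
  show "\<not> sublist (f [a, b, a', b']) (map cyc [0..<N])"
  proof
    assume sub: "sublist (f [a, b, a', b']) (map cyc [0..<N])"
    have "sublist u (f [a, b, a', b'])" "sublist v (f [a, b, a', b'])"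
      "sublist u' (f [a, b, a', b'])" "sublist v' (f [a, b, a', b'])"
      unfolding fp by (auto simp: sublist_append intro: sublist_appendI)
    then have "sublist u (map cyc [0..<N])" "sublist v (map cyc [0..<N])"
      "sublist u' (map cyc [0..<N])" "sublist v' (map cyc [0..<N])"
      using sub by (blast intro: sublist_order.order_trans)+
    moreover have "u' = u \<or> u' = rev u" "v' = v \<or> v' = rev v"
      using same_var_image[OF f(2)] assms(2,3) by (simp_all add: defs)
    ultimately have "u' = u" "v' = v" using rev_factor_cyc by metis+
    then have "sublist ((u @ v) @ (u @ v)) (map cyc [0..<N])" using sub fp by simp
    \<comment> \<open>This bound matters: \<open>cyc\<close> does contain doubled letters.\<close>
    moreover have "length (u @ v) \<ge> 2"
      using f(3) by (cases u; cases v) (auto simp: non_erasing_def defs)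
    ultimately show False using sublist_cyc_no_square by blast
  qed
qed

lemma not_same_var_trans: "\<not> same_var a b \<Longrightarrow> \<not> same_var b c \<Longrightarrow> same_var a c"
  by (auto simp: same_var_def)

text \<open>Patterns of length below 3 are padded, so that unavoidability is needed only for the
  shape \<open>[a, b, a']\<close>.\<close>

lemma avoidable_or_short:
  "k_avoidable 3 p \<or> (\<exists>a b a'. same_var a a' \<and> \<not> same_var a b \<and> sublist p [a, b, a'])"
proof (cases "\<exists>a b. sublist [a, b] p \<and> same_var a b")
  case True
  then show ?thesis using avoidable_adjacent by blast
next
  case False
  then have alt: "\<not> same_var a b" if "p = us @ [a, b] @ vs" for a b us vs
    using that by (metis sublist_appendI)
  have refl: "same_var a a" for a by (simp add: same_var_def)
  have ex: "\<exists>b. \<not> same_var a b" for a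
    by (cases a) (auto simp: same_var_def intro: exI[of _ x_let] exI[of _ y_let])
  consider "p = []" | a where "p = [a]" | a b where "p = [a, b]" | a b c where "p = [a, b, c]"
    | a b c d e where "p = a # b # c # d # e"
    by (metis list.exhaust)
  then show ?thesis
  proof cases
    case 1
    then show ?thesis using ex refl by blast
  next
    case 2
    moreover obtain b where "\<not> same_var a b" using ex by blast
    moreover have "sublist [a] [a, b, a]" by (simp add: sublist_Cons_right)
    ultimately show ?thesis using refl by blast
  next
    case 3
    then have "\<not> same_var a b" using alt[of "[]" a b "[]"] by simp
    moreover have "sublist [a, b] [a, b, a]" by (simp add: sublist_Cons_right)
    ultimately show ?thesis using refl 3 by blast
  next
    case 4
    then have "\<not> same_var a b" "\<not> same_var b c"
      using alt[of "[]" a b "[c]"] alt[of "[a]" b c "[]"] by simp_all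
    then show ?thesis using not_same_var_trans 4 by blast
  next
    case 5
    then have "\<not> same_var a b" "\<not> same_var b c" "\<not> same_var c d"
      using alt[of "[]" a b "c # d # e"] alt[of "[a]" b c "d # e"] alt[of "[a, b]" c d e] by simp_all
    moreover have "sublist [a, b, c, d] p" using 5 by (simp add: sublist_Cons_right)
    ultimately show ?thesis using avoidable_alternating not_same_var_trans by metis
  qed
qed

section \<open>Unavoidable patterns\<close>

lemma is_instanceI:
  assumes "\<And>a. g a \<in> lists (T k)" "\<And>a. g a \<noteq> []"
    and "g xR_let = rev (g x_let)" "g yR_let = rev (g y_let)"
  shows "is_instance k p (concat (map g p))"
proof -
  define f where "f = (\<lambda>p. concat (map g p))"
  have "morphism k f" using assms(1) by (fastforce simp: morphism_def f_def)
  moreover have "respects_reversal f" "non_erasing f"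
    using assms by (simp_all add: respects_reversal_def non_erasing_def f_def)
  ultimately show ?thesis unfolding is_instance_def f_def by blast
qed

text \<open>Pigeonhole on the \<open>k + 1\<close> even positions up to \<open>2 * k\<close>;
  distinct even positions leave a nonempty gap.\<close>

lemma repeated_letter:
  assumes "w \<in> lists (T k)" "length w \<ge> 2 * k + 1"
  obtains ps c mid ss where "w = ps @ [c] @ mid @ [c] @ ss" "mid \<noteq> []"
proof -
  have "(\<lambda>i. w ! (2 * i)) ` {..k} \<subseteq> {0..<k}"
    using assms by (auto simp: in_lists_conv_set T_def)
  then have "\<not> inj_on (\<lambda>i. w ! (2 * i)) {..k}"
    using card_inj_on_le[of "\<lambda>i. w ! (2 * i)" "{..k}" "{0..<k}"] by auto
  then obtain i j where ij: "i < j" "j \<le> k" "w ! (2 * i) = w ! (2 * j)"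
    unfolding inj_on_def by (metis atMost_iff nat_neq_iff)
  define mid where "mid = take (2 * j - 2 * i - 1) (drop (2 * i + 1) w)"
  have "w = take (2 * i) w @ [w ! (2 * i)] @ drop (2 * i + 1) w"
    using id_take_nth_drop[of "2 * i" w] ij assms(2) by simp
  moreover have "drop (2 * i + 1) w = mid @ drop (2 * j) w"
    using ij append_take_drop_id[of "2 * j - 2 * i - 1" "drop (2 * i + 1) w"]
    by (simp add: mid_def)
  moreover have "drop (2 * j) w = [w ! (2 * j)] @ drop (2 * j + 1) w"
    using Cons_nth_drop_Suc[of "2 * j" w] ij assms(2) by simp
  moreover have "mid \<noteq> []" using ij assms(2) by (auto simp: mid_def)
  ultimately show ?thesis using that ij(3) by metis
qed

lemma short_unavoidable:
  assumes "same_var a a'" "\<not> same_var a b"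
  shows "\<not> k_avoidable k [a, b, a']"
proof
  assume "k_avoidable k [a, b, a']"
  then obtain w where w: "w \<in> lists (T k)" "length w \<ge> 2 * k + 1" "avoids k w [a, b, a']"
    unfolding k_avoidable_def by blast
  obtain ps c mid ss where eq: "w = ps @ [c] @ mid @ [c] @ ss" and mid: "mid \<noteq> []"
    using repeated_letter[OF w(1,2)] .
  \<comment> \<open>The variable of \<open>a\<close> goes to a palindrome, so \<open>a\<close> and
    \<open>a'\<close> have the same image; the other variable is fixed by sending \<open>b\<close>
    to \<open>mid\<close>.\<close>
  define g where "g l = (if same_var a l then [c] else if l = b then mid else rev mid)" for l
  have "is_instance k [a, b, a'] (concat (map g [a, b, a']))"
  proof (rule is_instanceI)
    show "g l \<in> lists (T k)" "g l \<noteq> []" for l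
      using w(1) mid by (auto simp: g_def eq)
    show "g xR_let = rev (g x_let)" "g yR_let = rev (g y_let)"
      using assms(2) by (cases a; cases b; simp add: g_def same_var_def)+
  qed
  moreover have "concat (map g [a, b, a']) = [c] @ mid @ [c]"
    using assms by (cases a; cases b; cases a') (simp_all add: g_def same_var_def)
  ultimately have "is_instance k [a, b, a'] ([c] @ mid @ [c])" by simp
  moreover have "sublist ([c] @ mid @ [c]) w"
    unfolding eq by (metis append.assoc sublist_appendI)
  ultimately show False using w(3) by (simp add: avoids_def)
qed

section \<open>The possible indices\<close>

lemma k_avoidable_mono: "k_avoidable k q \<Longrightarrow> sublist q p \<Longrightarrow> k_avoidable k p"
  unfolding k_avoidable_def using avoids_mono by meson

lemma avoidable_imp_3_avoidable: "avoidable p \<Longrightarrow> k_avoidable 3 p"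
  using avoidable_or_short[of p] short_unavoidable k_avoidable_mono
  unfolding avoidable_def by metis

text \<open>Sending every letter to \<open>[0]\<close> gives an instance that is a prefix of any
  long enough unary word.\<close>

lemma not_1_avoidable: "\<not> k_avoidable 1 p"
proof
  assume "k_avoidable 1 p"
  then obtain w where w: "w \<in> lists (T 1)" "length w \<ge> length p" "avoids 1 w p"
    unfolding k_avoidable_def by blast
  have "w = replicate (length w) 0"
    using w(1) by (intro replicate_eqI) (auto simp: T_def in_lists_conv_set)
  also have "\<dots> = replicate (length p) 0 @ replicate (length w - length p) 0"
    using w(2) by (simp flip: replicate_add)
  finally have "sublist (replicate (length p) 0) w"
    by (metis append_Nil sublist_appendI)
  moreover have "is_instance 1 p (concat (map (\<lambda>_. [0]) p))"
    by (rule is_instanceI) (auto simp: T_def)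
  moreover have "concat (map (\<lambda>_. [0]) p) = replicate (length p) (0::nat)"
    by (induction p) auto
  ultimately show False using w(3) by (simp add: avoids_def)
qed

theorem theorem6:
  fixes p :: pattern
  shows "avoidability_index p = 2 \<or> avoidability_index p = 3 \<or> avoidability_index p = \<infinity>"
proof (cases "avoidable p")
  case True
  define l where "l = (LEAST k. k > 0 \<and> k_avoidable k p)"
  have 3: "3 > (0::nat) \<and> k_avoidable 3 p" using avoidable_imp_3_avoidable[OF True] by simp
  have "l > 0 \<and> k_avoidable l p" unfolding l_def using 3 by (rule LeastI)
  moreover have "l \<le> 3" unfolding l_def using 3 by (rule Least_le)
  moreover have "l \<noteq> 1" using calculation not_1_avoidable by auto
  ultimately have "l = 2 \<or> l = 3" by arith
  then show ?thesis
    using True by (auto simp: avoidability_index_def l_def[symmetric] numeral_eq_enat)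
qed (simp add: avoidability_index_def)

end
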